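(* Let $\alpha>0$, $\alpha\ne 1$. Consider a parametric family of probability distributions $\Pi=\{p_\theta:\theta\in\Theta\subset\mathbb{R}^k\}$ having a common support $\mathbb{S}$. Let $T=[T_1,\dots,T_s]^\top$ be $s$ statistics defined on $\mathbb{S}^n$, where $s\ge k$, and let $\mathscr{T}=\{T(y_1^n):y_1^n\in\mathbb{S}^n\}$. Then $T$ is a sufficient statistic for $\theta$ with respect to the Jones et al. likelihood function $L_J^{(\alpha)}$ if the following hold: (a) $\Pi$ is a $k$-parameter $\mathbb{M}^{(\alpha)}$-family characterized by $h,w=[w_1,\dots,w_s]^\top,f=[f_1,\dots,f_s]^\top,\Theta,\mathbb{S}$; (b) there exist real-valued functions $\psi_1,\dots,\psi_s$ defined on $\mathscr{T}$ such that for any i.i.d. sample $x_1^n$, $$\psi_i(T(x_1^n))=\overline{f_i}\big/\overline{h},\qquad i=1,\dots,s,$$ where $\overline{f_i}=\frac1n\sum_{j=1}^n f_i(x_j)$ and $\overline{h}=\frac1n\sum_{j=1}^n h(x_j)$.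
   Context: A $k$-parameter $\mathbb{M}^{(\alpha)}$-family ($\alpha$-power-law family) characterized by $h,w,f,\Theta,\mathbb{S}$, where $\Theta$ is an open subset of $\mathbb{R}^k$, $w=[w_1,\dots,w_s]^\top$ with each $w_i:\Theta\to\mathbb{R}$ differentiable, $f=[f_1,\dots,f_s]^\top$ with $f_i:\mathbb{R}\to\mathbb{R}$, $h:\mathbb{R}\to\mathbb{R}$, and $\mathbb{S}\subseteq\mathbb{R}$, is the set $\{p_\theta:\theta\in\Theta\}$ with $$p_\theta(x)=Z(\theta)\big[h(x)+w(\theta)^\top f(x)\big]^{\frac1{\alpha-1}}\ \text{for }x\in\mathbb{S},\qquad p_\theta(x)=0\text{ otherwise},$$ $Z(\theta)^{-1}=\int_{\mathbb{S}}[h(x)+w(\theta)^\top f(x)]^{\frac1{\alpha-1}}dx$. The Jones et al. likelihood function is $$L_J^{(\alpha)}(x_1^n;\theta)=\frac{1}{\alpha-1}\log\Big[\frac1n\sum_{i=1}^n p_\theta(x_i)^{\alpha-1}\Big]-\frac1\alpha\log\Big[\int p_\theta(x)^\alpha dx\Big].$$ Sufficiency: $T$ is a sufficient statistic for $\theta$ with respect to a likelihood function $L_G$ if, whenever $T(x_1^n)=T(y_1^n)$, the difference $L_G(x_1^n;\theta)-L_G(y_1^n;\theta)$ is independent of $\theta\in\Theta$. *)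

theory Defs
  imports "HOL-Probability.Probability"
begin

text \<open>
  Conventions. A sample of size \<open>n\<close> is a vector \<open>x :: real ^ 'n\<close> with \<open>n = CARD('n)\<close>. Integrals are
  Lebesgue integrals over the real line. A parametric family is a function
  \<open>p :: 'p \<Rightarrow> real \<Rightarrow> real\<close> together with a parameter set \<open>\<Theta>\<close>.
\<close>

definition samples :: "real set \<Rightarrow> (real ^ 'n) set" where
  "samples S = {x. \<forall>j. x $ j \<in> S}"

definition sample_mean :: "(real \<Rightarrow> real) \<Rightarrow> real ^ 'n \<Rightarrow> real" where
  "sample_mean g x = (1 / real CARD('n)) * (\<Sum>j\<in>UNIV. g (x $ j))"

definition prob_density :: "(real \<Rightarrow> real) \<Rightarrow> bool" where
  "prob_density q \<longleftrightarrow>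
     q \<in> borel_measurable lebesgue \<and> (\<forall>x. 0 \<le> q x) \<and>
     prob_space (density lebesgue (\<lambda>x. ennreal (q x)))"

text \<open>The support of a density is the set where it is positive; no closure is taken.\<close>

definition family_with_common_support :: "('p \<Rightarrow> real \<Rightarrow> real) \<Rightarrow> 'p set \<Rightarrow> real set \<Rightarrow> bool" where
  "family_with_common_support p \<Theta> S \<longleftrightarrow>
     (\<forall>\<theta>\<in>\<Theta>. prob_density (p \<theta>) \<and> {x. 0 < p \<theta> x} = S)"

definition power_law_normalizer ::
  "real \<Rightarrow> (real \<Rightarrow> real) \<Rightarrow> ('p \<Rightarrow> real ^ 's) \<Rightarrow> (real \<Rightarrow> real ^ 's) \<Rightarrow> real set \<Rightarrow> 'p \<Rightarrow> real" where
  "power_law_normalizer \<alpha> h w f S \<theta> =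
     inverse (LINT x:S|lebesgue. (h x + w \<theta> \<bullet> f x) powr (1 / (\<alpha> - 1)))"

text \<open>
  The bracket has to be positive for its real power to be meaningful, and the power has to be
  integrable for \<open>Z(\<theta>)\<close> to exist. Both are required explicitly, because \<open>powr\<close> and the
  Bochner integral are total and return default values outside their proper domains.
\<close>

definition power_law_family ::
  "real \<Rightarrow> (real \<Rightarrow> real) \<Rightarrow> (real ^ 'k \<Rightarrow> real ^ 's) \<Rightarrow> (real \<Rightarrow> real ^ 's) \<Rightarrow>
   (real ^ 'k) set \<Rightarrow> real set \<Rightarrow> (real ^ 'k \<Rightarrow> real \<Rightarrow> real) \<Rightarrow> bool" where
  "power_law_family \<alpha> h w f \<Theta> S p \<longleftrightarrow>
     open \<Theta> \<and>
     (\<forall>i. (\<lambda>\<theta>. w \<theta> $ i) differentiable_on \<Theta>) \<and>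
     (\<forall>\<theta>\<in>\<Theta>.
        (\<forall>x\<in>S. 0 < h x + w \<theta> \<bullet> f x) \<and>
        set_integrable lebesgue S (\<lambda>x. (h x + w \<theta> \<bullet> f x) powr (1 / (\<alpha> - 1))) \<and>
        (\<forall>x\<in>S. p \<theta> x =
           power_law_normalizer \<alpha> h w f S \<theta> * (h x + w \<theta> \<bullet> f x) powr (1 / (\<alpha> - 1))) \<and>
        (\<forall>x. x \<notin> S \<longrightarrow> p \<theta> x = 0))"

definition jones_likelihood :: "real \<Rightarrow> ('p \<Rightarrow> real \<Rightarrow> real) \<Rightarrow> real ^ 'n \<Rightarrow> 'p \<Rightarrow> real" where
  "jones_likelihood \<alpha> p x \<theta> =
     1 / (\<alpha> - 1) * ln (1 / real CARD('n) * (\<Sum>j\<in>UNIV. p \<theta> (x $ j) powr (\<alpha> - 1)))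
     - 1 / \<alpha> * ln (LINT y|lebesgue. p \<theta> y powr \<alpha>)"

text \<open>Only the values of \<open>T\<close> on \<open>samples S\<close> matter.\<close>

definition sufficient_statistic ::
  "(real ^ 'n \<Rightarrow> 'p \<Rightarrow> real) \<Rightarrow> 'p set \<Rightarrow> real set \<Rightarrow> (real ^ 'n \<Rightarrow> 't) \<Rightarrow> bool" where
  "sufficient_statistic L \<Theta> S T \<longleftrightarrow>
     (\<forall>x\<in>samples S. \<forall>y\<in>samples S. T x = T y \<longrightarrow> (\<lambda>\<theta>. L x \<theta> - L y \<theta>) constant_on \<Theta>)"

end

(* On the support, p_theta(x)^(alpha-1) is Z^(alpha-1) (h(x) + w(theta).f(x)), linear in (h, f), so its sample
   mean factors as hbar(x) times a quantity depending on x only through fbar/hbar, that is, through T(x).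
   If T(x) = T(y), the two means have the ratio hbar(x)/hbar(y), whatever theta is, and the logarithm
   turns this ratio into the difference of the likelihoods; the integral term cancels. *)

theory Submission
  imports Defs
begin

text \<open>Averaging is linear and the inner product with \<open>w \<theta>\<close> is a finite sum
  over coordinates, so the mean passes to each component of \<open>f\<close>. The assumption
  \<open>pos\<close> supplies the sign of the normalizer.\<close>

lemma power_law_sample_mean:
  fixes x :: "real ^ 'n" and f :: "real \<Rightarrow> real ^ 's"
  assumes "\<alpha> \<noteq> 1" and "power_law_family \<alpha> h w f \<Theta> S p" and "\<theta> \<in> \<Theta>"
    and "x \<in> samples S" and pos: "\<And>t. t \<in> S \<Longrightarrow> 0 < p \<theta> t"
  shows "sample_mean (\<lambda>t. p \<theta> t powr (\<alpha> - 1)) x =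
    power_law_normalizer \<alpha> h w f S \<theta> powr (\<alpha> - 1) *
      (sample_mean h x + (\<Sum>i\<in>UNIV. w \<theta> $ i * sample_mean (\<lambda>t. f t $ i) x))"
proof -
  define Z where "Z = power_law_normalizer \<alpha> h w f S \<theta>"
  have bracket: "0 < h t + w \<theta> \<bullet> f t"
    and p: "p \<theta> t = Z * (h t + w \<theta> \<bullet> f t) powr (1 / (\<alpha> - 1))" if "t \<in> S" for t
    using assms(2,3) that by (auto simp: power_law_family_def Z_def)
  have powr_p: "p \<theta> t powr (\<alpha> - 1) = Z powr (\<alpha> - 1) * (h t + w \<theta> \<bullet> f t)" if "t \<in> S" for t
  proof -
    \<comment> \<open>The sign of \<open>Z\<close> is read off from the density at \<open>t\<close>,
      since the other factor, a real power, is never negative. The normalizing integral need not be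
      examined.\<close>
    have "0 < Z"
      using pos[OF that] unfolding p[OF that] by (simp add: zero_less_mult_iff)
    \<comment> \<open>The two exponents multiply to 1, and \<open>b powr 1 = b\<close> for the
      positive bracket \<open>b\<close>.\<close>
    then show ?thesis
      using bracket[OF that] \<open>\<alpha> \<noteq> 1\<close> by (simp add: p[OF that] powr_mult powr_powr)
  qed
  have "(\<Sum>j\<in>UNIV. p \<theta> (x $ j) powr (\<alpha> - 1)) =
      (\<Sum>j\<in>UNIV. Z powr (\<alpha> - 1) * (h (x $ j) + w \<theta> \<bullet> f (x $ j)))"
    using assms(4) by (intro sum.cong refl powr_p) (auto simp: samples_def)
  also have "\<dots> = Z powr (\<alpha> - 1) *
      ((\<Sum>j\<in>UNIV. h (x $ j)) + (\<Sum>j\<in>UNIV. \<Sum>i\<in>UNIV. w \<theta> $ i * f (x $ j) $ i))"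
    by (simp add: sum_distrib_left[symmetric] sum.distrib inner_vec_def)
  also have "(\<Sum>j\<in>UNIV. \<Sum>i\<in>UNIV. w \<theta> $ i * f (x $ j) $ i) =
      (\<Sum>i\<in>UNIV. w \<theta> $ i * (\<Sum>j\<in>UNIV. f (x $ j) $ i))"
    by (subst sum.swap) (simp add: sum_distrib_left)
  finally show ?thesis
    by (simp add: sample_mean_def Z_def add_divide_distrib distrib_left sum_divide_distrib[symmetric])
qed

theorem theorem8:
  fixes \<alpha> :: real
    and p :: "real ^ 'k \<Rightarrow> real \<Rightarrow> real"
    and \<Theta> :: "(real ^ 'k) set"
    and S :: "real set"
    and T :: "real ^ 'n \<Rightarrow> real ^ 's"
    and h :: "real \<Rightarrow> real"
    and w :: "real ^ 'k \<Rightarrow> real ^ 's"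
    and f :: "real \<Rightarrow> real ^ 's"
  assumes "\<alpha> > 0" and "\<alpha> \<noteq> 1"
    and "family_with_common_support p \<Theta> S"
    and "CARD('s) \<ge> CARD('k)"
    and "power_law_family \<alpha> h w f \<Theta> S p"
    and "\<exists>\<psi> :: 's \<Rightarrow> real ^ 's \<Rightarrow> real. \<forall>x \<in> samples S. sample_mean h x \<noteq> 0 \<and>
           (\<forall>i. \<psi> i (T x) = sample_mean (\<lambda>t. f t $ i) x / sample_mean h x)"
  shows "sufficient_statistic (jones_likelihood \<alpha> p) \<Theta> S T"
proof -
  obtain \<psi> :: "'s \<Rightarrow> real ^ 's \<Rightarrow> real"
    where "\<forall>x\<in>samples S. sample_mean h x \<noteq> 0 \<and>
      (\<forall>i. \<psi> i (T x) = sample_mean (\<lambda>t. f t $ i) x / sample_mean h x)"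
    using assms(6) by blast
  then have h0: "sample_mean h x \<noteq> 0"
    and \<psi>: "\<psi> i (T x) = sample_mean (\<lambda>t. f t $ i) x / sample_mean h x"
    if "x \<in> samples S" for x i
    using that by auto
  have pos: "0 < p \<theta> t" if "\<theta> \<in> \<Theta>" "t \<in> S" for \<theta> t
    using assms(3) that by (auto simp: family_with_common_support_def)
  define M where "M \<theta> x = sample_mean (\<lambda>t. p \<theta> t powr (\<alpha> - 1)) x" for \<theta> and x :: "real ^ 'n"
  \<comment> \<open>The 1 is what the mean of \<open>h\<close> leaves once it is factored out. The
    argument is a value of \<open>T\<close>, not a sample, so equal statistics give literally the
    same factor.\<close>
  define c where "c \<theta> \<tau> = power_law_normalizer \<alpha> h w f S \<theta> powr (\<alpha> - 1) *
    (1 + (\<Sum>i\<in>UNIV. w \<theta> $ i * \<psi> i \<tau>))" for \<theta> \<tau>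
  have M_eq: "M \<theta> x = sample_mean h x * c \<theta> (T x)" if "\<theta> \<in> \<Theta>" "x \<in> samples S" for \<theta> x
  proof -
    \<comment> \<open>Clearing the denominator needs a nonzero mean of \<open>h\<close>: a quotient
      by 0 would be 0 and say nothing about the mean of \<open>f\<close>.\<close>
    have f: "sample_mean (\<lambda>t. f t $ i) x = sample_mean h x * \<psi> i (T x)" for i
      using h0 \<psi> that(2) by simp
    have "M \<theta> x = power_law_normalizer \<alpha> h w f S \<theta> powr (\<alpha> - 1) *
        (sample_mean h x + (\<Sum>i\<in>UNIV. w \<theta> $ i * sample_mean (\<lambda>t. f t $ i) x))"
      unfolding M_def by (rule power_law_sample_mean[OF assms(2,5) that]) (rule pos[OF that(1)])
    then show ?thesis
      by (simp add: c_def f algebra_simps sum_distrib_left)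
  qed
  have M_pos: "0 < M \<theta> x" if "\<theta> \<in> \<Theta>" "x \<in> samples S" for \<theta> x
  proof -
    have "p \<theta> (x $ j) \<noteq> 0" for j
      using pos[OF that(1), of "x $ j"] that(2) by (simp add: samples_def)
    then show ?thesis
      unfolding M_def sample_mean_def by (intro mult_pos_pos sum_pos) auto
  qed
  \<comment> \<open>The right-hand side depends on the two samples alone, so it is the witness that
    \<open>constant_on\<close> asks for.\<close>
  have "jones_likelihood \<alpha> p x \<theta> - jones_likelihood \<alpha> p y \<theta> =
      1 / (\<alpha> - 1) * ln (sample_mean h x / sample_mean h y)"
    if x: "x \<in> samples S" and y: "y \<in> samples S" and T: "T x = T y" and \<theta>: "\<theta> \<in> \<Theta>" for x y \<theta>
  proof -
    have "c \<theta> (T y) \<noteq> 0"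
      using M_pos[OF \<theta> y] M_eq[OF \<theta> y] by auto
    then have "M \<theta> x / M \<theta> y = sample_mean h x / sample_mean h y"
      by (simp add: M_eq[OF \<theta> x] M_eq[OF \<theta> y] T)
    \<comment> \<open>The logarithm is split on the means \<open>M\<close>, which are positive. The
      means of \<open>h\<close> may both be negative; only their ratio is known to be
      positive.\<close>
    then have "ln (sample_mean h x / sample_mean h y) = ln (M \<theta> x) - ln (M \<theta> y)"
      using ln_div[of "M \<theta> x" "M \<theta> y"] M_pos[OF \<theta> x] M_pos[OF \<theta> y] by simp
    then show ?thesis
      unfolding jones_likelihood_def M_def sample_mean_def by (simp add: right_diff_distrib diff_divide_distrib)
  qed
  then show ?thesis
    unfolding sufficient_statistic_def constant_on_def by blast
qed

end
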